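(* Let $A_1=(\mathcal{S}_1,\mathcal{E},\mathcal{I}_1,\mathcal{F}_1,\to_1)$ and $A_2=(\mathcal{S}_2,\mathcal{E},\mathcal{I}_2,\mathcal{F}_2,\to_2)$ be Büchi automata over the same set of events. For $X\subseteq\mathcal{S}_1\times\mathcal{S}_2$ define $$\texttt{fsim}^\texttt{R}_\texttt{delay}(X)\triangleq\mu Y.\ \{(s_1,s_2)\mid s_2\in\mathcal{F}_2\wedge\forall e.\forall s_1\xrightarrow{e}_1 s_1'.\exists s_2\xrightarrow{e}_2 s_2'.\ (s_1',s_2')\in X\}\ \cup\ \{(s_1,s_2)\mid \forall e.\forall s_1\xrightarrow{e}_1 s_1'.\exists s_2\xrightarrow{e}_2 s_2'.\ (s_1',s_2')\in Y\},$$ and $$\texttt{fsim}^\texttt{L}_\texttt{delay}\triangleq\nu X.\ \texttt{fsim}^\texttt{R}_\texttt{delay}(X)\ \cup\ \{(s_1,s_2)\mid s_1\notin\mathcal{F}_1\wedge\forall e.\forall s_1\xrightarrow{e}_1 s_1'.\exists s_2\xrightarrow{e}_2 s_2'.\ (s_1',s_2')\in X\}.$$ Then for all $(s_1,s_2)\in\texttt{fsim}^\texttt{L}_\texttt{delay}$, $\mathcal{L}_{A_1}(s_1)\subseteq\mathcal{L}_{A_2}(s_2)$.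
   Context: A Büchi automaton $(\mathcal{S},\mathcal{E},\mathcal{I},\mathcal{F},\to)$ consists of a set of states $\mathcal{S}$ (not necessarily finite), a set of events $\mathcal{E}$, initial states $\mathcal{I}\subseteq\mathcal{S}$, accepting states $\mathcal{F}\subseteq\mathcal{S}$, and a labeled transition relation $\to\subseteq\mathcal{S}\times\mathcal{E}\times\mathcal{S}$ (written $s\xrightarrow{e}s'$). $\nu$ and $\mu$ denote greatest and least fixed points of monotone operators on powerset lattices. The language of automaton $A$ is $\mathcal{L}_A\triangleq\nu L.\ \mu X.\ \{(s,e\cdot\tau)\mid \exists s\xrightarrow{e}s'.\ (s',\tau)\in X\}\cup\{(s,e\cdot\tau)\mid s\in\mathcal{F}\wedge \exists s\xrightarrow{e}s'.\ (s',\tau)\in L\}\subseteq\mathcal{S}\times\mathcal{E}^\omega$, and $\mathcal{L}_A(s)\triangleq\{\tau\mid (s,\tau)\in\mathcal{L}_A\}$. *)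

theory Defs
  imports Main "HOL-Library.Stream"
begin

record ('s, 'e) buchi =
  states :: "'s set"
  events :: "'e set"
  initial :: "'s set"
  accepting :: "'s set"
  transitions :: "('s \<times> 'e \<times> 's) set"

locale buchi_automaton =
  fixes A :: "('s, 'e) buchi"
  assumes initial_subset: "initial A \<subseteq> states A"
    and accepting_subset: "accepting A \<subseteq> states A"
    and trans_subset: "transitions A \<subseteq> states A \<times> events A \<times> states A"

text \<open>
  The fixed points below are meant in the powerset lattices of
  \<open>states A \<times> streams (events A)\<close> and of \<open>states A \<times> states B\<close>. They are taken with
  \<^const>\<open>lfp\<close> and \<^const>\<open>gfp\<close> over the whole type; the result of every operator lies in
  the carrier, so that the fixed points agree with those in the powerset of the carrier.
\<close>

definition lang_step ::
  "('s, 'e) buchi \<Rightarrow> ('s \<times> 'e stream) set \<Rightarrow> ('s \<times> 'e stream) set \<Rightarrow> ('s \<times> 'e stream) set"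
  where "lang_step A L X =
    ({(s, e ## \<tau>) | s e \<tau>. \<exists>s'. (s, e, s') \<in> transitions A \<and> (s', \<tau>) \<in> X} \<union>
     {(s, e ## \<tau>) | s e \<tau>. s \<in> accepting A \<and> (\<exists>s'. (s, e, s') \<in> transitions A \<and> (s', \<tau>) \<in> L)})
    \<inter> (states A \<times> streams (events A))"

definition language :: "('s, 'e) buchi \<Rightarrow> ('s \<times> 'e stream) set"
  where "language A = gfp (\<lambda>L. lfp (\<lambda>X. lang_step A L X))"

definition lang_of :: "('s, 'e) buchi \<Rightarrow> 's \<Rightarrow> 'e stream set"
  where "lang_of A s = {\<tau>. (s, \<tau>) \<in> language A}"

definition sim_step ::
  "('s, 'e) buchi \<Rightarrow> ('t, 'e) buchi \<Rightarrow> ('s \<times> 't) set \<Rightarrow> ('s \<times> 't) set"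
  where "sim_step A B X = {(s, t). s \<in> states A \<and> t \<in> states B \<and>
    (\<forall>e s'. (s, e, s') \<in> transitions A \<longrightarrow> (\<exists>t'. (t, e, t') \<in> transitions B \<and> (s', t') \<in> X))}"

definition fsimR_delay ::
  "('s, 'e) buchi \<Rightarrow> ('t, 'e) buchi \<Rightarrow> ('s \<times> 't) set \<Rightarrow> ('s \<times> 't) set"
  where "fsimR_delay A B X = lfp (\<lambda>Y.
    {(s, t). t \<in> accepting B \<and> (s, t) \<in> sim_step A B X} \<union> sim_step A B Y)"

definition fsimL_delay :: "('s, 'e) buchi \<Rightarrow> ('t, 'e) buchi \<Rightarrow> ('s \<times> 't) set"
  where "fsimL_delay A B = gfp (\<lambda>X.
    fsimR_delay A B X \<union> {(s, t). s \<notin> accepting A \<and> (s, t) \<in> sim_step A B X})"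

text \<open>All operators are monotone, so the definitions above do denote fixed points.\<close>

lemma lang_step_mono: "L \<subseteq> L' \<Longrightarrow> X \<subseteq> X' \<Longrightarrow> lang_step A L X \<subseteq> lang_step A L' X'"
  unfolding lang_step_def by blast

lemma mono_lang_step: "mono (lang_step A L)"
  by (simp add: lang_step_mono monoI)

lemma mono_lfp_lang_step: "mono (\<lambda>L. lfp (\<lambda>X. lang_step A L X))"
  by (intro monoI lfp_mono lang_step_mono order_refl)

lemma sim_step_mono: "X \<subseteq> Y \<Longrightarrow> sim_step A B X \<subseteq> sim_step A B Y"
  unfolding sim_step_def by blast

lemma mono_fsimR_delay_body:
  "mono (\<lambda>Y. {(s, t). t \<in> accepting B \<and> (s, t) \<in> sim_step A B X} \<union> sim_step A B Y)"
  by (intro monoI Un_mono sim_step_mono order_refl)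

lemma fsimR_delay_mono: "X \<subseteq> Y \<Longrightarrow> fsimR_delay A B X \<subseteq> fsimR_delay A B Y"
  unfolding fsimR_delay_def using sim_step_mono[of X Y A B]
  by (intro lfp_mono Un_mono order_refl) blast

lemma mono_fsimL_delay_body:
  fixes A :: "('a, 'e) buchi" and B :: "('b, 'e) buchi"
  shows "mono (\<lambda>X. fsimR_delay A B X \<union> {(s, t). s \<notin> accepting A \<and> (s, t) \<in> sim_step A B X})"
proof (intro monoI Un_mono fsimR_delay_mono)
  fix X Y :: "('a \<times> 'b) set"
  assume "X \<subseteq> Y"
  then show "{(s, t). s \<notin> accepting A \<and> (s, t) \<in> sim_step A B X}
    \<subseteq> {(s, t). s \<notin> accepting A \<and> (s, t) \<in> sim_step A B Y}"
    using sim_step_mono[of X Y A B] by blast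
qed

end

theory Submission
  imports Defs
begin

text \<open>
  By coinduction it suffices that the set \<open>W\<close> of all \<open>(t, \<tau>)\<close> with \<open>\<tau>\<close> accepted from some state
  related to \<open>t\<close> is contained in \<open>\<mu>X. lang_step B W X\<close>. An inner induction on the least fixed point
  \<^const>\<open>fsimR_delay\<close> shows that \<open>B\<close> visits an accepting state after finitely many steps.
  An outer induction on the least fixed point in \<open>language A\<close> covers the steps in which
  the pair is not in \<^const>\<open>fsimR_delay\<close>: there \<open>A\<close> is not accepting, so the
  distance of \<open>A\<close> to its next accepting state decreases.
\<close>

text \<open>Only the outer greatest fixed point is unrolled, so that a least fixed point remains to
  induct on.\<close>

lemma language_unfold: "language A = lfp (lang_step A (language A))"
  unfolding language_def by (rule gfp_unfold[OF mono_lfp_lang_step])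

lemma language_step: "language A = lang_step A (language A) (language A)"
  using lfp_unfold[OF mono_lang_step] language_unfold by metis

lemma fsimL_delay_unfold:
  "fsimL_delay A B = fsimR_delay A B (fsimL_delay A B) \<union>
    {(s, t). s \<notin> accepting A \<and> (s, t) \<in> sim_step A B (fsimL_delay A B)}"
  unfolding fsimL_delay_def by (rule gfp_unfold[OF mono_fsimL_delay_body])

lemma language_cases:
  assumes "(s, \<sigma>) \<in> language A"
  obtains e \<tau> s' where "\<sigma> = e ## \<tau>" and "(s, e, s') \<in> transitions A" and "(s', \<tau>) \<in> language A"
  using assms language_step[of A] unfolding lang_step_def by blast

lemma language_streams: "(s, \<tau>) \<in> language A \<Longrightarrow> \<tau> \<in> streams (events A)"
  using language_step[of A] unfolding lang_step_def by blast

lemma lfp_lang_step_step: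
  assumes "s \<in> states A" and "e ## \<tau> \<in> streams (events A)" and "(s, e, s') \<in> transitions A"
    and "(s', \<tau>) \<in> lfp (lang_step A L)"
  shows "(s, e ## \<tau>) \<in> lfp (lang_step A L)"
  using assms by (subst lfp_unfold[OF mono_lang_step]) (auto simp: lang_step_def)

lemma lfp_lang_step_accepting:
  assumes "s \<in> states A" and "e ## \<tau> \<in> streams (events A)" and "(s, e, s') \<in> transitions A"
    and "s \<in> accepting A" and "(s', \<tau>) \<in> L"
  shows "(s, e ## \<tau>) \<in> lfp (lang_step A L)"
  using assms by (subst lfp_unfold[OF mono_lang_step]) (auto simp: lang_step_def)

lemma sim_stepE:
  assumes "(s, t) \<in> sim_step A B X" and "(s, e, s') \<in> transitions A"
  obtains t' where "t \<in> states B" and "(t, e, t') \<in> transitions B" and "(s', t') \<in> X"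
  using assms unfolding sim_step_def by blast

text \<open>Each unrolling of \<open>fsimR_delay\<close> answers one step of A. If t is accepting,
  the successor need only be in \<open>W\<close>; otherwise the induction hypothesis puts it in the
  least fixed point. Acceptance in A is never consulted.\<close>

lemma fsimR_delay_language:
  assumes ev: "events A = events B"
    and sim: "(s, t) \<in> fsimR_delay A B X" and lang: "(s, \<sigma>) \<in> language A"
    and W: "\<And>s t \<tau>. (s, t) \<in> X \<Longrightarrow> (s, \<tau>) \<in> language A \<Longrightarrow> (t, \<tau>) \<in> W"
  shows "(t, \<sigma>) \<in> lfp (lang_step B W)"
  using sim[unfolded fsimR_delay_def] lang
proof (induction s t arbitrary: \<sigma>
    rule: lfp_induct2[OF _ mono_fsimR_delay_body, consumes 1, case_names step])
  case (step s t)
  obtain e \<tau> s' where trans: "\<sigma> = e ## \<tau>" "(s, e, s') \<in> transitions A" "(s', \<tau>) \<in> language A"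
    using step.prems by (rule language_cases)
  have str: "e ## \<tau> \<in> streams (events B)"
    using language_streams[OF step.prems] ev trans(1) by simp
  \<comment> \<open>The induction predicate as a set, with the word quantified because it shrinks at
    each step.\<close>
  let ?P = "{(s, t). \<forall>\<sigma>. (s, \<sigma>) \<in> language A \<longrightarrow> (t, \<sigma>) \<in> lfp (lang_step B W)}"
  from step.IH consider
      (acc) "t \<in> accepting B" "(s, t) \<in> sim_step A B X"
    | (delay) "(s, t) \<in> sim_step A B ?P"
    using sim_step_mono[OF Int_lower2, of A B _ ?P] by auto
  then show ?case
  proof cases
    case acc
    from acc(2) trans(2) obtain t'
      where "t \<in> states B" "(t, e, t') \<in> transitions B" "(s', t') \<in> X"
      by (rule sim_stepE)
    with acc(1) str trans(1,3) show ?thesis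
      by (auto intro: lfp_lang_step_accepting W)
  next
    case delay
    from delay trans(2) obtain t'
      where "t \<in> states B" "(t, e, t') \<in> transitions B" "(t', \<tau>) \<in> lfp (lang_step B W)"
      by (rule sim_stepE) (use trans(3) in blast)
    with str trans(1) show ?thesis
      by (auto intro: lfp_lang_step_step)
  qed
qed

lemma fsimL_delay_language:
  assumes ev: "events A = events B"
    and sim: "(s, t) \<in> fsimL_delay A B" and lang: "(s, \<sigma>) \<in> language A"
    and W: "\<And>s t \<tau>. (s, t) \<in> fsimL_delay A B \<Longrightarrow> (s, \<tau>) \<in> language A \<Longrightarrow> (t, \<tau>) \<in> W"
  shows "(t, \<sigma>) \<in> lfp (lang_step B W)"
  using subsetD[OF equalityD1[OF language_unfold] lang] sim
proof (induction s \<sigma> arbitrary: t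
    rule: lfp_induct2[OF _ mono_lang_step, consumes 1, case_names step])
  case (step s \<sigma>)
  let ?I = "lfp (lang_step A (language A)) \<inter>
    {(s, \<sigma>). \<forall>t. (s, t) \<in> fsimL_delay A B \<longrightarrow> (t, \<sigma>) \<in> lfp (lang_step B W)}"
  have hyp: "(s, \<sigma>) \<in> lang_step A (language A) ?I"
    using step.IH by simp
  \<comment> \<open>The induction hypothesis no longer records that the word is accepted from s; the
    least fixed point inside \<open>?I\<close> is \<open>language A\<close>, which recovers it for
    the case \<open>right\<close>.\<close>
  have "(s, \<sigma>) \<in> lang_step A (language A) (language A)"
    using hyp lang_step_mono[OF order_refl, of ?I "language A" A "language A"]
      language_unfold[of A] by blast
  then have lang: "(s, \<sigma>) \<in> language A"
    using language_step[of A] by blast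
  from step.prems consider (right) "(s, t) \<in> fsimR_delay A B (fsimL_delay A B)"
    | (left) "s \<notin> accepting A" "(s, t) \<in> sim_step A B (fsimL_delay A B)"
    using fsimL_delay_unfold[of A B] by blast
  then show ?case
  proof cases
    case right
    from ev this lang W show ?thesis by (rule fsimR_delay_language)
  next
    case left
    \<comment> \<open>As s is not accepting, only the first branch of \<open>lang_step\<close>
      applies, so the successor lies in \<open>?I\<close> and not just in
      \<open>language A\<close>.\<close>
    from hyp left(1) obtain e \<tau> s'
      where trans: "\<sigma> = e ## \<tau>" "(s, e, s') \<in> transitions A" "(s', \<tau>) \<in> ?I"
      unfolding lang_step_def by blast
    have str: "e ## \<tau> \<in> streams (events B)"
      using language_streams[OF lang] ev trans(1) by simp
    from left(2) trans(2) obtain t'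
      where "t \<in> states B" "(t, e, t') \<in> transitions B" "(s', t') \<in> fsimL_delay A B"
      by (rule sim_stepE)
    with str trans(1,3) show ?thesis
      by (auto intro: lfp_lang_step_step)
  qed
qed

theorem theorem4p4:
  fixes A1 :: "('s, 'e) buchi" and A2 :: "('t, 'e) buchi"
  assumes "buchi_automaton A1" and "buchi_automaton A2"
    and "events A1 = events A2"
  shows "\<forall>(s1, s2) \<in> fsimL_delay A1 A2. lang_of A1 s1 \<subseteq> lang_of A2 s2"
proof -
  define W where
    "W = {(t, \<tau>). \<exists>s. (s, t) \<in> fsimL_delay A1 A2 \<and> (s, \<tau>) \<in> language A1}"
  \<comment> \<open>The closure assumption on \<open>W\<close> holds by its definition.\<close>
  have "W \<subseteq> lfp (lang_step A2 W)"
    using fsimL_delay_language[OF assms(3), where W = W] unfolding W_def by blast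
  then have "W \<subseteq> language A2"
    unfolding language_def by (rule gfp_upperbound)
  then show ?thesis
    unfolding W_def lang_of_def by blast
qed

end
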